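(* Let $n\ge2$ and $\tau_i=(c_i,d_i,p_i,J_i)$, $i=1,\dots,n$, nonnegative integers with $c_i\ge1$, $p_i\ge1$, $c_i\le d_i\le p_i$, $0\le J_i\le p_i$, $\sum_{i<n}c_i/p_i<1$, and harmonic periods. Let $\emptyset\ne I\subseteq\{1,\dots,n-1\}$, $\gamma\in\mathbb{Z}_{\ge1}$, and \[ \mathcal{R}(I,\gamma)=\min\Big\{t\in\mathbb{Z}_{\ge0}: t\ge \gamma+\sum_{i\in I}c_i\Big\lceil\frac{t+J_i}{p_i}\Big\rceil\Big\}. \] If $k$ is an integer with $k\ge\max_{i\in I}p_i$, then whether $\mathcal{R}(I,\gamma)\le k$ holds can be decided using $O(n^2)$ arithmetic operations.
   Context: Periods are harmonic if $p_i\ge p_j$ implies $p_i/p_j\in\mathbb{Z}$. Running times count arithmetic operations on numbers from the input. *)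

theory Defs
  imports Complex_Main "HOL-Library.Landau_Symbols"
begin

text \<open>
  Tasks are indexed by \<open>1, \<dots>, n\<close>; the values of \<open>c\<close>, \<open>d\<close>, \<open>p\<close>, \<open>J\<close> at other indices are irrelevant.
\<close>

definition harmonic :: "nat \<Rightarrow> (nat \<Rightarrow> nat) \<Rightarrow> bool" where
  "harmonic n p \<longleftrightarrow>
     (\<forall>i\<in>{1..n}. \<forall>j\<in>{1..n}. p i \<ge> p j \<longrightarrow> real (p i) / real (p j) \<in> \<int>)"

definition task_system ::
  "nat \<Rightarrow> (nat \<Rightarrow> nat) \<Rightarrow> (nat \<Rightarrow> nat) \<Rightarrow> (nat \<Rightarrow> nat) \<Rightarrow> (nat \<Rightarrow> nat) \<Rightarrow> bool" where
  "task_system n c d p J \<longleftrightarrow>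
     (\<forall>i\<in>{1..n}. 1 \<le> c i \<and> 1 \<le> p i \<and> c i \<le> d i \<and> d i \<le> p i \<and> J i \<le> p i) \<and>
     (\<Sum>i\<in>{1..<n}. real (c i) / real (p i)) < 1"

definition response_bound ::
  "(nat \<Rightarrow> nat) \<Rightarrow> (nat \<Rightarrow> nat) \<Rightarrow> (nat \<Rightarrow> nat) \<Rightarrow> nat set \<Rightarrow> nat \<Rightarrow> nat \<Rightarrow> bool" where
  "response_bound c p J I \<gamma> t \<longleftrightarrow>
     int t \<ge> int \<gamma> + (\<Sum>i\<in>I. int (c i) * \<lceil>(real t + real (J i)) / real (p i)\<rceil>)"

definition response_time ::
  "(nat \<Rightarrow> nat) \<Rightarrow> (nat \<Rightarrow> nat) \<Rightarrow> (nat \<Rightarrow> nat) \<Rightarrow> nat set \<Rightarrow> nat \<Rightarrow> nat" where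
  "response_time c p J I \<gamma> = (LEAST t. response_bound c p J I \<gamma> t)"

text \<open>The minimum is attained, so \<open>LEAST\<close> above is not applied to an empty set.\<close>

lemma response_bound_response_time:
  assumes "task_system n c d p J" "I \<subseteq> {1..n - 1}"
  shows "response_bound c p J I \<gamma> (response_time c p J I \<gamma>)"
proof -
  define U where "U = (\<Sum>i\<in>I. real (c i) / real (p i))"
  define B where "B = real \<gamma> + (\<Sum>i\<in>I. real (c i) * (real (J i) / real (p i) + 1))"
  have sub: "I \<subseteq> {1..<n}"
    using assms(2) by fastforce
  have "U \<le> (\<Sum>i\<in>{1..<n}. real (c i) / real (p i))"
    unfolding U_def by (rule sum_mono2) (use sub in auto)
  then have U: "U < 1"
    using assms(1) by (simp add: task_system_def)
  obtain t :: nat where t: "B / (1 - U) \<le> real t"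
    using real_arch_simple by blast
  then have B: "B \<le> real t * (1 - U)"
    using U by (simp add: pos_divide_le_eq)
  have "real_of_int (int \<gamma> + (\<Sum>i\<in>I. int (c i) * \<lceil>(real t + real (J i)) / real (p i)\<rceil>))
      = real \<gamma> + (\<Sum>i\<in>I. real (c i) * real_of_int \<lceil>(real t + real (J i)) / real (p i)\<rceil>)"
    by simp
  also have "\<dots> \<le> real \<gamma> + (\<Sum>i\<in>I. real (c i) * ((real t + real (J i)) / real (p i) + 1))"
    by (intro add_left_mono sum_mono mult_left_mono) (auto intro: of_int_ceiling_le_add_one)
  also have "\<dots> = B + real t * U"
    by (simp add: B_def U_def sum_distrib_left sum.distrib add_divide_distrib algebra_simps)
  also have "\<dots> \<le> real_of_int (int t)"
    using B by (simp add: algebra_simps)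
  finally have "response_bound c p J I \<gamma> t"
    unfolding response_bound_def of_int_le_iff .
  then show ?thesis
    unfolding response_time_def by (rule LeastI)
qed

text \<open>
  Unit-cost random access machine over the integers, as a structured language with integer
  variables and unbounded integer arrays. Every constant, variable or array access, arithmetic
  operation, comparison, Boolean connective, assignment and branch costs one step, so the step
  count bounds in particular the number of arithmetic operations. \<open>Div\<close> is floor division.
\<close>

type_synonym vname = string

datatype aexp =
    Const int
  | Var vname
  | Read vname aexp
  | Add aexp aexp
  | Sub aexp aexp
  | Mul aexp aexp
  | Div aexp aexp

datatype bexp =
    Less aexp aexp
  | Neg bexp
  | Conj bexp bexp

datatype com =
    Skip
  | Assign vname aexp
  | Write vname aexp aexp
  | Seq com com
  | Cond bexp com com
  | While bexp com

record state =
  scalar :: "vname \<Rightarrow> int"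
  array :: "vname \<Rightarrow> int \<Rightarrow> int"

primrec aval :: "aexp \<Rightarrow> state \<Rightarrow> int" where
  "aval (Const m) s = m"
| "aval (Var x) s = scalar s x"
| "aval (Read a e) s = array s a (aval e s)"
| "aval (Add e f) s = aval e s + aval f s"
| "aval (Sub e f) s = aval e s - aval f s"
| "aval (Mul e f) s = aval e s * aval f s"
| "aval (Div e f) s = aval e s div aval f s"

primrec acost :: "aexp \<Rightarrow> nat" where
  "acost (Const m) = 1"
| "acost (Var x) = 1"
| "acost (Read a e) = acost e + 1"
| "acost (Add e f) = acost e + acost f + 1"
| "acost (Sub e f) = acost e + acost f + 1"
| "acost (Mul e f) = acost e + acost f + 1"
| "acost (Div e f) = acost e + acost f + 1"

primrec bval :: "bexp \<Rightarrow> state \<Rightarrow> bool" where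
  "bval (Less e f) s \<longleftrightarrow> aval e s < aval f s"
| "bval (Neg b) s \<longleftrightarrow> \<not> bval b s"
| "bval (Conj b b') s \<longleftrightarrow> bval b s \<and> bval b' s"

primrec bcost :: "bexp \<Rightarrow> nat" where
  "bcost (Less e f) = acost e + acost f + 1"
| "bcost (Neg b) = bcost b + 1"
| "bcost (Conj b b') = bcost b + bcost b' + 1"

text \<open>\<open>exec P s m s'\<close>: started in \<open>s\<close>, program \<open>P\<close> halts after exactly \<open>m\<close> steps in \<open>s'\<close>.\<close>

inductive exec :: "com \<Rightarrow> state \<Rightarrow> nat \<Rightarrow> state \<Rightarrow> bool" where
  exec_Skip: "exec Skip s 1 s"
| exec_Assign:
    "exec (Assign x e) s (acost e + 1) (s\<lparr>scalar := (scalar s)(x := aval e s)\<rparr>)"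
| exec_Write:
    "exec (Write a i e) s (acost i + acost e + 1)
       (s\<lparr>array := (array s)(a := (array s a)(aval i s := aval e s))\<rparr>)"
| exec_Seq:
    "exec P s m s' \<Longrightarrow> exec Q s' m' s'' \<Longrightarrow> exec (Seq P Q) s (m + m') s''"
| exec_CondTrue:
    "bval b s \<Longrightarrow> exec P s m s' \<Longrightarrow> exec (Cond b P Q) s (bcost b + 1 + m) s'"
| exec_CondFalse:
    "\<not> bval b s \<Longrightarrow> exec Q s m s' \<Longrightarrow> exec (Cond b P Q) s (bcost b + 1 + m) s'"
| exec_WhileFalse:
    "\<not> bval b s \<Longrightarrow> exec (While b P) s (bcost b + 1) s"
| exec_WhileTrue:
    "bval b s \<Longrightarrow> exec P s m s' \<Longrightarrow> exec (While b P) s' m' s'' \<Longrightarrow>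
       exec (While b P) s (bcost b + 1 + m + m') s''"

inductive_cases exec_SkipE: "exec Skip s m s'"
  and exec_AssignE: "exec (Assign x e) s m s'"
  and exec_WriteE: "exec (Write a i e) s m s'"
  and exec_SeqE: "exec (Seq P Q) s m s'"
  and exec_CondE: "exec (Cond b P Q) s m s'"
  and exec_WhileE: "exec (While b P) s m s'"

lemma exec_deterministic:
  "exec P s m s' \<Longrightarrow> exec P s l r' \<Longrightarrow> l = m \<and> r' = s'"
proof (induction arbitrary: l r' rule: exec.induct)
  case (exec_Skip s)
  then show ?case by (rule exec_SkipE) simp
next
  case (exec_Assign x e s)
  then show ?case by (rule exec_AssignE) simp
next
  case (exec_Write a i e s)
  then show ?case by (rule exec_WriteE) simp
next
  case (exec_Seq P s m s' Q m' s'')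
  from exec_Seq.prems obtain l1 r1 l2
    where "l = l1 + l2" "exec P s l1 r1" "exec Q r1 l2 r'"
    by (rule exec_SeqE)
  with exec_Seq.IH show ?case by metis
next
  case (exec_CondTrue b s P m s' Q)
  from exec_CondTrue.prems exec_CondTrue.hyps(1) obtain l1
    where "l = Suc (bcost b + l1)" "exec P s l1 r'"
    by (blast elim: exec_CondE)
  with exec_CondTrue.IH show ?case by simp
next
  case (exec_CondFalse b s Q m s' P)
  from exec_CondFalse.prems exec_CondFalse.hyps(1) obtain l1
    where "l = Suc (bcost b + l1)" "exec Q s l1 r'"
    by (blast elim: exec_CondE)
  with exec_CondFalse.IH show ?case by simp
next
  case (exec_WhileFalse b s P)
  from exec_WhileFalse.prems show ?case
    by (rule exec_WhileE) (simp_all add: exec_WhileFalse.hyps)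
next
  case (exec_WhileTrue b s P m s' m' s'')
  from exec_WhileTrue.prems exec_WhileTrue.hyps(1) obtain l1 r1 l2
    where "l = Suc (bcost b + l1 + l2)" "exec P s l1 r1" "exec (While b P) r1 l2 r'"
    by (blast elim: exec_WhileE)
  moreover from this exec_WhileTrue.IH have "l1 = m" "r1 = s'"
    by blast+
  ultimately show ?case using exec_WhileTrue.IH(2) by simp
qed

definition decides_within :: "com \<Rightarrow> state \<Rightarrow> nat \<Rightarrow> bool \<Rightarrow> bool" where
  "decides_within P s b Q \<longleftrightarrow>
     (\<exists>m s'. exec P s m s' \<and> m \<le> b \<and> scalar s' ''result'' = (if Q then 1 else 0))"

text \<open>
  Only the input is present in memory initially: all variables and array cells not listed are \<open>0\<close>,
  and the set \<open>I\<close> is given by its indicator array.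
\<close>

definition input_array :: "nat \<Rightarrow> (nat \<Rightarrow> nat) \<Rightarrow> int \<Rightarrow> int" where
  "input_array n f i = (if 1 \<le> i \<and> i \<le> int n then int (f (nat i)) else 0)"

definition input_state ::
  "nat \<Rightarrow> (nat \<Rightarrow> nat) \<Rightarrow> (nat \<Rightarrow> nat) \<Rightarrow> (nat \<Rightarrow> nat) \<Rightarrow> (nat \<Rightarrow> nat)
     \<Rightarrow> nat set \<Rightarrow> nat \<Rightarrow> int \<Rightarrow> state" where
  "input_state n c d p J I \<gamma> k =
     \<lparr>scalar = (\<lambda>_. 0)(''n'' := int n, ''gamma'' := int \<gamma>, ''k'' := k),
      array = (\<lambda>_ _. 0)(''c'' := input_array n c, ''d'' := input_array n d,
        ''p'' := input_array n p, ''J'' := input_array n J,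
        ''I'' := input_array n (\<lambda>i. if i \<in> I then 1 else 0))\<rparr>"

end

theory Submission
  imports Defs
begin

text \<open>
  Substitute \<open>u = - t\<close> and, for a set \<open>S\<close> of tasks, put
  \<open>f S u = (\<Sum>i\<in>S. c i * ((u - J i) div p i)) - u\<close>, so that \<open>\<R>(I, \<gamma>) \<le> k\<close> says that
  \<open>f I u \<ge> \<gamma>\<close> for some \<open>u\<close> with \<open>- k \<le> u \<le> 0\<close>. If every period in \<open>S\<close> divides \<open>q\<close>, then
  \<open>f S (u + q) = f S u - D\<close> with \<open>D = q - (\<Sum>i\<in>S. c i * (q div p i)) \<ge> 0\<close>. Since \<open>k\<close> is at least
  the largest period, the restriction \<open>u \<le> 0\<close> can therefore be dropped, and it suffices to compute
  \<open>h I (- k)\<close>, where \<open>h S b\<close> is the maximum of \<open>f S\<close> over all \<open>u \<ge> b\<close>.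
  Tasks are added to \<open>S\<close> in the order of increasing periods. When a task \<open>j\<close> is added, with
  \<open>q = p j\<close> and \<open>e = (b - J j) div q\<close>, a point \<open>u \<ge> b\<close> either has \<open>(u - J j) div q = e\<close>, or it can
  be shifted by a multiple of \<open>q\<close> to a point \<open>u \<ge> J j\<close> at which task \<open>j\<close> contributes \<open>0\<close>. Hence
  \<open>h (insert j S) b = max (h S b + c j * e) (h S (J j) - (e + 1) * D)\<close>, with \<open>D\<close> taken
  for \<open>insert j S\<close>, and it is enough to tabulate \<open>h S\<close> at the \<open>n + 1\<close> points \<open>- k, J 1, \<dots>, J n\<close>.
\<close>

section \<open>Peaks of demand functions\<close>

text \<open>A relation instead of \<open>Max\<close> or \<open>Sup\<close>, since the half-line is
  infinite. Attainment is included because the final test needs a witness, not only an upper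
  bound.\<close>

definition is_peak :: "(int \<Rightarrow> int) \<Rightarrow> int \<Rightarrow> int \<Rightarrow> bool" where
  "is_peak f b h \<longleftrightarrow> (\<exists>u\<ge>b. f u = h) \<and> (\<forall>u\<ge>b. f u \<le> h)"

lemma is_peakI:
  assumes "u \<ge> b" "f u \<ge> h" "\<And>u. u \<ge> b \<Longrightarrow> f u \<le> h"
  shows "is_peak f b h"
  using assms unfolding is_peak_def by (metis order_antisym)

text \<open>The upper bound is the shifting argument. For attainment, a maximiser of
  \<open>f\<close> from \<open>b\<close> on has quotient at least \<open>e\<close>, and a maximiser
  from \<open>J\<close> on, moved by \<open>e + 1\<close> periods, lands beyond \<open>b\<close>;
  here \<open>e + 1\<close> may be negative.\<close>

lemma is_peak_add_task:
  fixes f g :: "int \<Rightarrow> int"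
  assumes q: "q > 0" and c: "c \<ge> 0" and D: "D \<ge> 0"
    and g: "\<And>u. g u = f u + c * ((u - J) div q)"
    and shift: "\<And>u m. g (u + q * m) = g u - m * D"
    and x: "is_peak f b x" and h: "is_peak f J h"
    and e: "e = (b - J) div q"
  shows "is_peak g b (max (x + c * e) (h - (e + 1) * D))"
proof -
  have upper: "g u \<le> max (x + c * e) (h - (e + 1) * D)" if u: "u \<ge> b" for u
  proof (cases "(u - J) div q = e")
    case True
    then show ?thesis using x u by (auto simp: g is_peak_def)
  next
    case False
    define a where "a = (u - J) div q"
    have "a \<ge> e"
      unfolding a_def e using q u by (intro zdiv_mono1) auto
    with False have a: "a \<ge> e + 1" by (simp add: a_def)
    \<comment> \<open>\<open>v\<close> is the representative of \<open>u\<close> modulo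
      \<open>q\<close> in the window of length \<open>q\<close> starting at
      \<open>J\<close>.\<close>
    define v where "v = u - q * a"
    have "v - J = (u - J) mod q"
      by (simp add: v_def a_def minus_mult_div_eq_mod [symmetric])
    then have v: "v \<ge> J" "(v - J) div q = 0"
      using q by (simp_all add: pos_mod_sign div_pos_pos_trivial)
       (use pos_mod_sign [OF q, of "u - J"] in linarith)
    have "g v \<le> h"
      using h v by (simp add: g is_peak_def)
    moreover have "g u = g v - a * D"
      using shift [of v a] by (simp add: v_def)
    moreover have "(e + 1) * D \<le> a * D"
      using a D by (rule mult_right_mono)
    ultimately show ?thesis by linarith
  qed
  obtain u where u: "u \<ge> b" "f u = x"
    using x by (auto simp: is_peak_def)
  have "e \<le> (u - J) div q"
    unfolding e using q u by (intro zdiv_mono1) auto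
  then have gu: "g u \<ge> x + c * e"
    using c by (simp add: g u mult_left_mono)
  obtain v where v: "v \<ge> J" "f v = h"
    using h by (auto simp: is_peak_def)
  have "g v \<ge> h"
    using c q v by (simp add: g pos_imp_zdiv_nonneg_iff)
  then have gv: "g (v + q * (e + 1)) \<ge> h - (e + 1) * D"
    by (simp only: shift)
  have "b - J < q * (e + 1)"
    unfolding e using q
    by (metis add.commute div_mult_mod_eq distrib_left mult.commute mult.right_neutral
        add_less_cancel_right pos_mod_bound)
  with v have "v + q * (e + 1) \<ge> b" by simp
  with u gu gv upper show ?thesis
    by (cases "x + c * e \<le> h - (e + 1) * D") (auto intro: is_peakI)
qed

section \<open>Demand under shifts by a common multiple of the periods, and its slack\<close>

definition demand :: "('a \<Rightarrow> int) \<Rightarrow> ('a \<Rightarrow> int) \<Rightarrow> ('a \<Rightarrow> int) \<Rightarrow> 'a set \<Rightarrow> int \<Rightarrow> int" where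
  "demand c p J S u = (\<Sum>i\<in>S. c i * ((u - J i) div p i)) - u"

text \<open>For a common multiple \<open>q\<close> of positive periods this is \<open>q\<close>
  times one minus the utilisation of \<open>S\<close>. The index type stays open in both
  definitions: response times index tasks by \<open>nat\<close>, programs by
  \<open>int\<close>.\<close>

definition slack :: "('a \<Rightarrow> int) \<Rightarrow> ('a \<Rightarrow> int) \<Rightarrow> 'a set \<Rightarrow> int \<Rightarrow> int" where
  "slack c p S q = q - (\<Sum>i\<in>S. c i * (q div p i))"

text \<open>As \<open>p i\<close> divides \<open>q\<close>, each quotient moves by exactly
  \<open>m * (q div p i)\<close>, and the linear term moves by \<open>q * m\<close>. Negative
  \<open>m\<close> is included.\<close>

lemma demand_shift:
  assumes "\<And>i. i \<in> S \<Longrightarrow> p i > 0" "\<And>i. i \<in> S \<Longrightarrow> p i dvd q"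
  shows "demand c p J S (u + q * m) = demand c p J S u - m * slack c p S q"
proof -
  have "(u + q * m - J i) div p i = (u - J i) div p i + m * (q div p i)" if "i \<in> S" for i
  proof -
    obtain l where l: "q = p i * l" using assms(2) [OF \<open>i \<in> S\<close>] by (rule dvdE)
    have "u + q * m - J i = u - J i + p i * (l * m)"
      by (simp add: l)
    then have "(u + q * m - J i) div p i = l * m + (u - J i) div p i"
      using assms(1) [OF that] by (simp only: div_mult_self2)
    then show ?thesis
      using assms(1) [OF that] by (simp add: l)
  qed
  then have "(\<Sum>i\<in>S. c i * ((u + q * m - J i) div p i)) =
      (\<Sum>i\<in>S. c i * ((u - J i) div p i) + m * (c i * (q div p i)))"
    by (intro sum.cong) (auto simp: algebra_simps)
  then show ?thesis
    by (simp add: demand_def slack_def sum.distrib sum_distrib_left [symmetric] algebra_simps)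
qed

lemma slack_nonneg:
  assumes "q \<ge> 0" "\<And>i. i \<in> S \<Longrightarrow> p i dvd q"
    and util: "(\<Sum>i\<in>S. real_of_int (c i) / real_of_int (p i)) \<le> 1"
  shows "slack c p S q \<ge> 0"
proof -
  have "real_of_int (\<Sum>i\<in>S. c i * (q div p i)) =
      (\<Sum>i\<in>S. real_of_int q * (real_of_int (c i) / real_of_int (p i)))"
    unfolding of_int_sum using assms(2)
    by (intro sum.cong) (auto simp: real_of_int_div)
  also have "\<dots> = real_of_int q * (\<Sum>i\<in>S. real_of_int (c i) / real_of_int (p i))"
    by (simp add: sum_distrib_left)
  also have "\<dots> \<le> real_of_int q * 1"
    using assms(1) util by (intro mult_left_mono) auto
  finally show ?thesis
    unfolding slack_def by linarith
qed

text \<open>Passing from \<open>q\<close> to \<open>p j\<close> scales every old term by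
  \<open>p j div q\<close>, and the new task takes off \<open>c j\<close>. Hence the program can
  update \<open>D\<close> in constant time instead of summing again.\<close>

lemma slack_insert:
  assumes "finite S" "j \<notin> S" "\<And>i. i \<in> S \<Longrightarrow> p i dvd q" "q dvd p j" "q > 0" "p j > 0"
  shows "slack c p (insert j S) (p j) = slack c p S q * (p j div q) - c j"
proof -
  obtain l where l: "p j = q * l" using assms(4) ..
  have "c i * (p j div p i) = c i * (q div p i) * l" if "i \<in> S" for i
    using assms(3) [OF that] by (auto simp: l div_mult_swap mult.commute mult.left_commute)
  then have "(\<Sum>i\<in>S. c i * (p j div p i)) = (\<Sum>i\<in>S. c i * (q div p i)) * l"
    unfolding sum_distrib_right by (intro sum.cong refl)
  then show ?thesis
    using assms by (simp add: slack_def) (simp add: l algebra_simps)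
qed

section \<open>Running times of programs\<close>

text \<open>Total correctness with a step budget; an upper bound in place of an exact count lets
  branches of different cost be combined.\<close>

definition runs :: "com \<Rightarrow> state \<Rightarrow> nat \<Rightarrow> (state \<Rightarrow> bool) \<Rightarrow> bool" where
  "runs P s b Q \<longleftrightarrow> (\<exists>m s'. exec P s m s' \<and> m \<le> b \<and> Q s')"

lemma runs_mono:
  assumes "runs P s b Q" "b \<le> b'" "\<And>s'. Q s' \<Longrightarrow> Q' s'"
  shows "runs P s b' Q'"
  using assms unfolding runs_def by (meson order_trans)

lemma runs_Seq:
  assumes "runs P s b R" "\<And>s'. R s' \<Longrightarrow> runs P' s' b' Q"
  shows "runs (Seq P P') s (b + b') Q"
proof -
  from assms(1) obtain m s' where m: "exec P s m s'" "m \<le> b" "R s'"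
    by (auto simp: runs_def)
  from assms(2) [OF m(3)] obtain m' s'' where "exec P' s' m' s''" "m' \<le> b'" "Q s''"
    by (auto simp: runs_def)
  with m show ?thesis
    unfolding runs_def by (meson exec_Seq add_mono)
qed

lemma runs_Cond:
  assumes "bval g s \<Longrightarrow> runs P s b Q" "\<not> bval g s \<Longrightarrow> runs P' s b' Q"
  shows "runs (Cond g P P') s (bcost g + 1 + max b b') Q"
proof (cases "bval g s")
  case True
  with assms(1) obtain m s' where "exec P s m s'" "m \<le> b" "Q s'"
    by (auto simp: runs_def)
  with exec_CondTrue [OF True this(1), of P'] show ?thesis
    unfolding runs_def by (intro exI conjI) auto
next
  case False
  with assms(2) obtain m s' where "exec P' s m s'" "m \<le> b'" "Q s'"
    by (auto simp: runs_def)
  with exec_CondFalse [OF False this(1), of P] show ?thesis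
    unfolding runs_def by (intro exI conjI) auto
qed

text \<open>The invariant carries the iteration number and decides the guard, so the loop makes
  exactly \<open>N\<close> passes; termination and the budget follow together.\<close>

lemma runs_While:
  assumes start: "R 0 s"
    and body: "\<And>i s. i < N \<Longrightarrow> R i s \<Longrightarrow> bval g s \<and> runs P s b (R (Suc i))"
    and stop: "\<And>s. R N s \<Longrightarrow> \<not> bval g s"
  shows "runs (While g P) s (N * (bcost g + 1 + b) + (bcost g + 1)) (R N)"
proof -
  \<comment> \<open>Generalised to a loop entered after \<open>i\<close> passes with
    \<open>l\<close> still to come, for induction on \<open>l\<close>.\<close>
  have "runs (While g P) s (l * (bcost g + 1 + b) + (bcost g + 1)) (R N)"
    if "R i s" "i + l = N" for i l s
    using that
  proof (induction l arbitrary: i s)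
    case 0
    then have "\<not> bval g s" using stop by simp
    from exec_WhileFalse [OF this, of P] 0 show ?case
      by (auto simp: runs_def intro!: exI)
  next
    case (Suc l)
    then have g: "bval g s" and "runs P s b (R (Suc i))"
      using body [of i s] by auto
    then obtain m s' where m: "exec P s m s'" "m \<le> b" "R (Suc i) s'"
      by (auto simp: runs_def)
    from Suc.IH [OF m(3)] Suc.prems obtain m' s'' where
      m': "exec (While g P) s' m' s''" "m' \<le> l * (bcost g + 1 + b) + (bcost g + 1)" "R N s''"
      by (auto simp: runs_def)
    from exec_WhileTrue [OF g m(1) m'(1)] m m' show ?case
      unfolding runs_def by (intro exI conjI) auto
  qed
  from this [OF start, of N] show ?thesis by simp
qed

text \<open>Only meaningful for loop-free programs: loops get the junk values \<open>False\<close> and \<open>0\<close>.\<close>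

primrec wp :: "com \<Rightarrow> (state \<Rightarrow> bool) \<Rightarrow> state \<Rightarrow> bool" where
  "wp Skip Q s = Q s"
| "wp (Assign x e) Q s = Q (s\<lparr>scalar := (scalar s)(x := aval e s)\<rparr>)"
| "wp (Write a i e) Q s = Q (s\<lparr>array := (array s)(a := (array s a)(aval i s := aval e s))\<rparr>)"
| "wp (Seq P P') Q s = wp P (wp P' Q) s"
| "wp (Cond g P P') Q s = (if bval g s then wp P Q s else wp P' Q s)"
| "wp (While g P) Q s = False"

primrec ccost :: "com \<Rightarrow> nat" where
  "ccost Skip = 1"
| "ccost (Assign x e) = acost e + 1"
| "ccost (Write a i e) = acost i + acost e + 1"
| "ccost (Seq P P') = ccost P + ccost P'"
| "ccost (Cond g P P') = bcost g + 1 + max (ccost P) (ccost P')"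
| "ccost (While g P) = 0"

text \<open>Reduces loop-free code to simplification: \<open>wp\<close> computes the effect and
  \<open>ccost\<close> a static budget. The loop case is vacuous, as \<open>wp\<close> is
  \<open>False\<close> there.\<close>

lemma runs_wp: "wp P Q s \<Longrightarrow> runs P s (ccost P) Q"
proof (induction P arbitrary: Q s)
  case (Seq P P')
  show ?case
    unfolding ccost.simps
    by (rule runs_Seq [where R = "wp P' Q"]) (use Seq in auto)
next
  case (Cond g P P')
  show ?case
    unfolding ccost.simps by (rule runs_Cond) (use Cond in auto)
qed (auto simp: runs_def intro!: exI exec.intros)

section \<open>The decision procedure\<close>

text \<open>Without tasks the demand is \<open>- u\<close>, whose peak from \<open>J i\<close> on is
  \<open>- J i\<close>.\<close>

definition init_body :: com where
  "init_body =
     Seq (Write ''H'' (Var ''i'') (Sub (Const 0) (Read ''J'' (Var ''i''))))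
         (Assign ''i'' (Add (Var ''i'') (Const 1)))"

text \<open>\<open>J 0 = - k\<close> makes \<open>- k\<close> one of the tabulated points.\<close>

definition init_prog :: com where
  "init_prog =
     Seq (Seq (Write ''J'' (Const 0) (Sub (Const 0) (Var ''k'')))
         (Seq (Assign ''q'' (Const 1))
              (Assign ''D'' (Const 1))))
         (While (Less (Var ''i'') (Add (Var ''n'') (Const 1))) init_body)"

text \<open>Tasks start at index 1, so \<open>j = 0\<close> encodes that no candidate has been
  found. The nested negations express the disjunction that \<open>j\<close> is unset or
  \<open>p i < p j\<close>.\<close>

definition select_body :: com where
  "select_body =
     Seq (Assign ''i'' (Add (Var ''i'') (Const 1)))
         (Cond (Conj (Less (Const 0) (Read ''I'' (Var ''i'')))
                     (Neg (Conj (Less (Const 0) (Var ''j''))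
                                (Neg (Less (Read ''p'' (Var ''i'')) (Read ''p'' (Var ''j'')))))))
            (Assign ''j'' (Var ''i''))
            Skip)"

definition select_prog :: com where
  "select_prog =
     Seq (Seq (Assign ''r'' (Add (Var ''r'') (Const 1)))
         (Seq (Assign ''i'' (Const 0))
              (Assign ''j'' (Const 0))))
         (While (Less (Var ''i'') (Var ''n'')) select_body)"

definition update_body :: com where
  "update_body =
     Seq (Assign ''e'' (Div (Sub (Read ''J'' (Var ''i'')) (Read ''J'' (Var ''j''))) (Var ''q'')))
    (Seq (Write ''H'' (Var ''i'')
            (Add (Read ''H'' (Var ''i'')) (Mul (Read ''c'' (Var ''j'')) (Var ''e''))))
    (Seq (Assign ''x'' (Sub (Var ''h'') (Mul (Add (Var ''e'') (Const 1)) (Var ''D''))))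
    (Seq (Cond (Less (Read ''H'' (Var ''i'')) (Var ''x''))
            (Write ''H'' (Var ''i'') (Var ''x''))
            Skip)
         (Assign ''i'' (Add (Var ''i'') (Const 1))))))"

text \<open>\<open>D\<close> is updated while \<open>q\<close> still holds the previous period, and
  \<open>h\<close> saves \<open>H j\<close> because the loop overwrites that cell. Clearing
  \<open>I j\<close> records that the task has been added.\<close>

definition update_prog :: com where
  "update_prog =
     Seq (Seq (Write ''I'' (Var ''j'') (Const 0))
         (Seq (Assign ''D'' (Sub (Mul (Var ''D'') (Div (Read ''p'' (Var ''j'')) (Var ''q'')))
                                 (Read ''c'' (Var ''j''))))
         (Seq (Assign ''q'' (Read ''p'' (Var ''j'')))
         (Seq (Assign ''h'' (Read ''H'' (Var ''j'')))
              (Assign ''i'' (Const 0))))))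
         (While (Less (Var ''i'') (Add (Var ''n'') (Const 1))) update_body)"

text \<open>Once all tasks are added, a round only scans; the number of rounds can therefore be
  fixed at \<open>n\<close>.\<close>

definition round_prog :: com where
  "round_prog = Seq select_prog (Cond (Less (Const 0) (Var ''j'')) update_prog Skip)"

definition decide_prog :: com where
  "decide_prog =
     Seq init_prog
    (Seq (While (Less (Var ''r'') (Var ''n'')) round_prog)
         (Cond (Less (Read ''H'' (Const 0)) (Var ''gamma''))
            (Assign ''result'' (Const 0))
            (Assign ''result'' (Const 1))))"

section \<open>Effects and step counts of the subprograms\<close>

lemma select_prog_runs:
  assumes n: "scalar s ''n'' = int n"
  shows "runs select_prog s (n * 30 + 20)
     (\<lambda>s'. \<exists>j. s' = s\<lparr>scalar := (scalar s)(''r'' := scalar s ''r'' + 1, ''i'' := int n, ''j'' := j)\<rparr> \<and>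
        (j = 0 \<and> (\<forall>l\<in>{1..int n}. array s ''I'' l \<le> 0) \<or>
         j \<in> {1..int n} \<and> array s ''I'' j > 0 \<and>
         (\<forall>l\<in>{1..int n}. array s ''I'' l > 0 \<longrightarrow> array s ''p'' j \<le> array s ''p'' l)))"
    (is "runs _ _ _ ?Q")
proof -
  define R where "R m s' \<longleftrightarrow> (\<exists>j. s' = s\<lparr>scalar := (scalar s)(''r'' := scalar s ''r'' + 1, ''i'' := int m, ''j'' := j)\<rparr> \<and>
        (j = 0 \<and> (\<forall>l\<in>{1..int m}. array s ''I'' l \<le> 0) \<or>
         j \<in> {1..int m} \<and> array s ''I'' j > 0 \<and>
         (\<forall>l\<in>{1..int m}. array s ''I'' l > 0 \<longrightarrow> array s ''p'' j \<le> array s ''p'' l)))" for m s'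
  have ivl: "{1..1 + int m} = insert (1 + int m) {1..int m}" for m
    by auto
  have body: "bval (Less (Var ''i'') (Var ''n'')) s' \<and>
      runs select_body s' (ccost select_body) (R (Suc m))" if "m < n" "R m s'" for m s'
  proof -
    from that(2) obtain j where s':
      "s' = s\<lparr>scalar := (scalar s)(''r'' := scalar s ''r'' + 1, ''i'' := int m, ''j'' := j)\<rparr>"
      and j: "j = 0 \<and> (\<forall>l\<in>{1..int m}. array s ''I'' l \<le> 0) \<or>
         j \<in> {1..int m} \<and> array s ''I'' j > 0 \<and>
         (\<forall>l\<in>{1..int m}. array s ''I'' l > 0 \<longrightarrow> array s ''p'' j \<le> array s ''p'' l)"
      by (auto simp: R_def)
    have "wp select_body (R (Suc m)) s'"
      using j by (fastforce simp: select_body_def R_def s' ivl fun_upd_twist add.commute)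
    then have "runs select_body s' (ccost select_body) (R (Suc m))"
      by (rule runs_wp)
    with that(1) n show ?thesis by (simp add: s')
  qed
  have stop: "\<not> bval (Less (Var ''i'') (Var ''n'')) s'" if "R n s'" for s'
    using that n by (auto simp: R_def)
  have "runs select_prog s (8 + (n * (bcost (Less (Var ''i'') (Var ''n'')) + 1 + ccost select_body) +
      (bcost (Less (Var ''i'') (Var ''n'')) + 1))) (R n)"
    unfolding select_prog_def
  proof (rule runs_Seq [where R = "R 0"])
    show "runs (Seq (Assign ''r'' (Add (Var ''r'') (Const 1)))
         (Seq (Assign ''i'' (Const 0)) (Assign ''j'' (Const 0)))) s 8 (R 0)"
      by (rule runs_mono [OF runs_wp [where Q = "R 0"]]) (auto simp: R_def)
  qed (rule runs_While [where R = R, OF _ body stop])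
  then show ?thesis
    by (rule runs_mono) (simp_all add: select_body_def R_def)
qed

text \<open>The loop relies on \<open>i\<close> being \<open>0\<close> in the initial memory.
  Overwriting \<open>J 0\<close> loses no input, since tasks start at index 1.\<close>

lemma init_prog_runs:
  assumes n: "scalar s ''n'' = int n" and i: "scalar s ''i'' = 0"
    and J: "J = (array s ''J'')(0 := - scalar s ''k'')"
  shows "runs init_prog s (n * 17 + 31)
     (\<lambda>s'. s' = s\<lparr>scalar := (scalar s)(''q'' := 1, ''D'' := 1, ''i'' := int n + 1),
        array := (array s)(''J'' := J,
          ''H'' := (\<lambda>l. if 0 \<le> l \<and> l \<le> int n then - J l else array s ''H'' l))\<rparr>)"
proof -
  define R where "R m s' \<longleftrightarrow>
      s' = s\<lparr>scalar := (scalar s)(''q'' := 1, ''D'' := 1, ''i'' := int m),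
        array := (array s)(''J'' := J,
          ''H'' := (\<lambda>l. if 0 \<le> l \<and> l < int m then - J l else array s ''H'' l))\<rparr>" for m s'
  let ?g = "Less (Var ''i'') (Add (Var ''n'') (Const 1))"
  have body: "bval ?g s' \<and> runs init_body s' (ccost init_body) (R (Suc m))"
    if "m < Suc n" "R m s'" for m s'
  proof -
    have "wp init_body (R (Suc m)) s'"
      using that by (auto simp: init_body_def R_def fun_upd_twist fun_eq_iff)
    then have "runs init_body s' (ccost init_body) (R (Suc m))"
      by (rule runs_wp)
    with that n show ?thesis by (simp add: R_def)
  qed
  have stop: "\<not> bval ?g s'" if "R (Suc n) s'" for s'
    using that n by (auto simp: R_def)
  have "runs init_prog s (9 + (Suc n * (bcost ?g + 1 + ccost init_body) + (bcost ?g + 1))) (R (Suc n))"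
    unfolding init_prog_def
  proof (rule runs_Seq [where R = "R 0"])
    show "runs (Seq (Write ''J'' (Const 0) (Sub (Const 0) (Var ''k'')))
         (Seq (Assign ''q'' (Const 1)) (Assign ''D'' (Const 1)))) s 9 (R 0)"
      by (rule runs_mono [OF runs_wp [where Q = "R 0"]]) (use i in \<open>auto simp: R_def J fun_eq_iff\<close>)
  qed (rule runs_While [where R = R, OF _ body stop])
  then show ?thesis
    by (rule runs_mono) (auto simp: init_body_def R_def fun_eq_iff)
qed

text \<open>The new table is expressed through the old one alone: updating in place is sound because
  row \<open>l\<close> reads only its own cell of \<open>H\<close> and the saved \<open>h\<close>.
  The final values of the scratch variables \<open>e\<close> and \<open>x\<close> are left
  open.\<close>

lemma update_prog_runs:
  assumes n: "scalar s ''n'' = int n" and j: "scalar s ''j'' = j"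
    and q: "q = array s ''p'' j"
    and D: "D = scalar s ''D'' * (q div scalar s ''q'') - array s ''c'' j"
  shows "runs update_prog s (n * 43 + 72)
     (\<lambda>s'. \<exists>e x. s' = s\<lparr>scalar := (scalar s)(''D'' := D, ''q'' := q, ''h'' := array s ''H'' j,
          ''i'' := int n + 1, ''e'' := e, ''x'' := x),
        array := (array s)(''I'' := (array s ''I'')(j := 0),
          ''H'' := (\<lambda>l. if 0 \<le> l \<and> l \<le> int n then
             (let e = (array s ''J'' l - array s ''J'' j) div q in
              max (array s ''H'' l + array s ''c'' j * e) (array s ''H'' j - (e + 1) * D))
             else array s ''H'' l))\<rparr>)"
proof -
  define H where "H l = (let e = (array s ''J'' l - array s ''J'' j) div q in
              max (array s ''H'' l + array s ''c'' j * e) (array s ''H'' j - (e + 1) * D))" for l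
  define R where "R m s' \<longleftrightarrow>
      (\<exists>e x. s' = s\<lparr>scalar := (scalar s)(''D'' := D, ''q'' := q, ''h'' := array s ''H'' j,
          ''i'' := int m, ''e'' := e, ''x'' := x),
        array := (array s)(''I'' := (array s ''I'')(j := 0),
          ''H'' := (\<lambda>l. if 0 \<le> l \<and> l < int m then H l else array s ''H'' l))\<rparr>)" for m s'
  let ?g = "Less (Var ''i'') (Add (Var ''n'') (Const 1))"
  have body: "bval ?g s' \<and> runs update_body s' (ccost update_body) (R (Suc m))"
    if m: "m < Suc n" "R m s'" for m s'
  proof -
    obtain e x where s': "s' = s\<lparr>scalar := (scalar s)(''D'' := D, ''q'' := q, ''h'' := array s ''H'' j,
          ''i'' := int m, ''e'' := e, ''x'' := x),
        array := (array s)(''I'' := (array s ''I'')(j := 0),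
          ''H'' := (\<lambda>l. if 0 \<le> l \<and> l < int m then H l else array s ''H'' l))\<rparr>"
      using m(2) unfolding R_def by blast
    define e' where "e' = (array s ''J'' (int m) - array s ''J'' j) div q"
    have "wp update_body (\<lambda>s'. s' = s\<lparr>scalar := (scalar s)(''D'' := D, ''q'' := q, ''h'' := array s ''H'' j,
          ''i'' := int (Suc m), ''e'' := e', ''x'' := array s ''H'' j - (e' + 1) * D),
        array := (array s)(''I'' := (array s ''I'')(j := 0),
          ''H'' := (\<lambda>l. if 0 \<le> l \<and> l < int (Suc m) then H l else array s ''H'' l))\<rparr>) s'"
      by (auto simp: update_body_def s' e'_def j fun_eq_iff H_def Let_def max_def)
    then have "runs update_body s' (ccost update_body) (R (Suc m))"
      by (rule runs_mono [OF runs_wp]) (auto simp: R_def)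
    with m n show ?thesis by (simp add: s')
  qed
  have stop: "\<not> bval ?g s'" if "R (Suc n) s'" for s'
    using that n by (auto simp: R_def)
  have "runs update_prog s (21 + (Suc n * (bcost ?g + 1 + ccost update_body) + (bcost ?g + 1))) (R (Suc n))"
    unfolding update_prog_def
  proof (rule runs_Seq [where R = "R 0"])
    show "runs (Seq (Write ''I'' (Var ''j'') (Const 0))
         (Seq (Assign ''D'' (Sub (Mul (Var ''D'') (Div (Read ''p'' (Var ''j'')) (Var ''q'')))
                                 (Read ''c'' (Var ''j''))))
         (Seq (Assign ''q'' (Read ''p'' (Var ''j'')))
         (Seq (Assign ''h'' (Read ''H'' (Var ''j'')))
              (Assign ''i'' (Const 0)))))) s 21 (R 0)"
      apply (rule runs_mono [OF runs_wp [where Q = "R 0"]])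
      apply (simp_all add: R_def j)
      \<comment> \<open>Before the first pass the scratch variables still have their old
        values.\<close>
      apply (rule exI [of _ "scalar s ''e''"], rule exI [of _ "scalar s ''x''"])
      apply (auto simp: q D fun_eq_iff)
      done
  qed (rule runs_While [where R = R, OF _ body stop])
  moreover have "(\<lambda>l. if 0 \<le> l \<and> l < int (Suc n) then H l else array s ''H'' l) =
      (\<lambda>l. if 0 \<le> l \<and> l \<le> int n then
             (let e = (array s ''J'' l - array s ''J'' j) div q in
              max (array s ''H'' l + array s ''c'' j * e) (array s ''H'' j - (e + 1) * D))
             else array s ''H'' l)"
    by (auto simp: fun_eq_iff H_def)
  moreover have "int (Suc n) = int n + 1"
    by simp
  ultimately show ?thesis
    by (elim runs_mono) (simp add: update_body_def, simp only: R_def)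
qed

section \<open>The loop invariant and correctness of the program, with tasks as integer array
  indices\<close>

locale harmonic_demand =
  fixes n :: nat and \<gamma> :: int and c p J :: "int \<Rightarrow> int" and A :: "int set"
  assumes A: "A \<subseteq> {1..int n}"
    and p_pos: "i \<in> A \<Longrightarrow> p i > 0"
    and c_nonneg: "i \<in> A \<Longrightarrow> c i \<ge> 0"
    and p_dvd: "i \<in> A \<Longrightarrow> j \<in> A \<Longrightarrow> p i \<le> p j \<Longrightarrow> p i dvd p j"
    and util: "(\<Sum>i\<in>A. real_of_int (c i) / real_of_int (p i)) \<le> 1"
begin

lemma finite_A: "finite A"
  using A by (rule finite_subset) simp

lemma util_subset:
  assumes "S \<subseteq> A"
  shows "(\<Sum>i\<in>S. real_of_int (c i) / real_of_int (p i)) \<le> 1"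
proof -
  have "(\<Sum>i\<in>S. real_of_int (c i) / real_of_int (p i)) \<le>
      (\<Sum>i\<in>A. real_of_int (c i) / real_of_int (p i))"
    by (intro sum_mono2 finite_A assms divide_nonneg_pos) (auto simp: p_pos c_nonneg)
  with util show ?thesis by simp
qed

text \<open>\<open>S\<close> is the set of tasks added in the first \<open>r\<close> rounds, one per
  round until \<open>A\<close> is exhausted. The variable \<open>q\<close> separates the periods: a
  multiple of those in \<open>S\<close> and a divisor of the remaining ones.\<close>

definition tabulates :: "int set \<Rightarrow> nat \<Rightarrow> state \<Rightarrow> bool" where
  "tabulates S r s \<longleftrightarrow> S \<subseteq> A \<and> (S = A \<or> card S = r) \<and> scalar s ''q'' > 0 \<and>
     (\<forall>i\<in>S. p i dvd scalar s ''q'') \<and> (\<forall>i\<in>A - S. scalar s ''q'' dvd p i) \<and>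
     scalar s ''n'' = int n \<and> scalar s ''gamma'' = \<gamma> \<and> scalar s ''r'' = int r \<and>
     scalar s ''D'' = slack c p S (scalar s ''q'') \<and>
     array s ''c'' = c \<and> array s ''p'' = p \<and> array s ''J'' = J \<and>
     (\<forall>i\<in>{1..int n}. array s ''I'' i > 0 \<longleftrightarrow> i \<in> A - S) \<and>
     (\<forall>i\<in>{0..int n}. is_peak (demand c p J S) (J i) (array s ''H'' i))"

text \<open>\<open>p j\<close> is a common multiple of the periods in \<open>insert j S\<close>, so
  a shift by it costs exactly the slack, which the utilisation bound makes nonnegative.\<close>

lemma is_peak_demand_insert:
  assumes S: "S \<subseteq> A" and j: "j \<in> A - S" and dvd: "\<And>i. i \<in> S \<Longrightarrow> p i dvd p j"
    and x: "is_peak (demand c p J S) b x" and h: "is_peak (demand c p J S) (J j) h"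
    and e: "e = (b - J j) div p j"
  shows "is_peak (demand c p J (insert j S)) b
           (max (x + c j * e) (h - (e + 1) * slack c p (insert j S) (p j)))"
proof (rule is_peak_add_task [OF _ _ _ _ _ x h e])
  show "0 < p j" "0 \<le> c j" using j by (auto simp: p_pos c_nonneg)
  have fin: "finite S" using S finite_A by (rule finite_subset)
  show "0 \<le> slack c p (insert j S) (p j)"
    using S j dvd p_pos [of j] by (intro slack_nonneg util_subset) auto
  show "demand c p J (insert j S) u = demand c p J S u + c j * ((u - J j) div p j)" for u
    using fin j by (simp add: demand_def)
  show "demand c p J (insert j S) (u + p j * m) =
      demand c p J (insert j S) u - m * slack c p (insert j S) (p j)" for u m
    using S j dvd by (intro demand_shift) (auto simp: p_pos)
qed

text \<open>The budget adds \<open>n * 30 + 20\<close> for the selection, \<open>4\<close> for the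
  branch on \<open>j\<close> and \<open>n * 43 + 72\<close> for the update.\<close>

lemma round_prog_runs:
  assumes inv: "\<exists>S. tabulates S r s"
  shows "runs round_prog s (n * 73 + 96) (\<lambda>s. \<exists>S. tabulates S (Suc r) s)"
proof -
  define q where "q = scalar s ''q''"
  from inv obtain S where tab: "tabulates S r s" ..
  then have S: "S \<subseteq> A" "S = A \<or> card S = r" and q: "q > 0"
    and below: "\<And>i. i \<in> S \<Longrightarrow> p i dvd q" and above: "\<And>i. i \<in> A - S \<Longrightarrow> q dvd p i"
    and n: "scalar s ''n'' = int n"
    and sc: "scalar s ''gamma'' = \<gamma>" "scalar s ''r'' = int r"
     "scalar s ''q'' = q" "scalar s ''D'' = slack c p S q"
    and ar: "array s ''c'' = c" "array s ''p'' = p" "array s ''J'' = J"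
    and I: "\<And>i. i\<in>{1..int n} \<Longrightarrow> array s ''I'' i > 0 \<longleftrightarrow> i \<in> A - S"
    and H: "\<And>i. i\<in>{0..int n} \<Longrightarrow> is_peak (demand c p J S) (J i) (array s ''H'' i)"
    by (simp_all add: tabulates_def q_def)
  have fin: "finite S" using S(1) finite_A by (rule finite_subset)
  show ?thesis
    unfolding round_prog_def
  proof (rule runs_mono [OF runs_Seq [OF select_prog_runs [OF n] runs_Cond]])
    fix s'
    assume "\<exists>j. s' = s\<lparr>scalar := (scalar s)(''r'' := scalar s ''r'' + 1, ''i'' := int n, ''j'' := j)\<rparr> \<and>
        (j = 0 \<and> (\<forall>l\<in>{1..int n}. array s ''I'' l \<le> 0) \<or>
         j \<in> {1..int n} \<and> array s ''I'' j > 0 \<and>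
         (\<forall>l\<in>{1..int n}. array s ''I'' l > 0 \<longrightarrow> array s ''p'' j \<le> array s ''p'' l))"
    then obtain j where
      s': "s' = s\<lparr>scalar := (scalar s)(''r'' := scalar s ''r'' + 1, ''i'' := int n, ''j'' := j)\<rparr>"
      and cases: "j = 0 \<and> (\<forall>l\<in>{1..int n}. array s ''I'' l \<le> 0) \<or>
         j \<in> {1..int n} \<and> array s ''I'' j > 0 \<and>
         (\<forall>l\<in>{1..int n}. array s ''I'' l > 0 \<longrightarrow> array s ''p'' j \<le> array s ''p'' l)"
      by blast
    {
      assume "\<not> bval (Less (Const 0) (Var ''j'')) s'"
      with cases have "\<forall>l\<in>{1..int n}. array s ''I'' l \<le> 0" by (auto simp: s')
      \<comment> \<open>No task is left, so the invariant survives through its disjunct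
        \<open>S = A\<close> although \<open>card S\<close> does not grow.\<close>
      with I A S(1) have "S = A" by force
      with q below above n sc ar I H have "tabulates S (Suc r) s'"
        by (simp add: tabulates_def s')
      then have "\<exists>S. tabulates S (Suc r) s'" ..
      then show "runs Skip s' 1 (\<lambda>s. \<exists>S. tabulates S (Suc r) s)"
        by (intro runs_mono [OF runs_wp [where Q = "\<lambda>s. \<exists>S. tabulates S (Suc r) s"]]) auto
    next
      assume "bval (Less (Const 0) (Var ''j'')) s'"
      with cases have jn: "j \<in> {1..int n}" and "array s ''I'' j > 0"
        and least: "\<forall>l\<in>{1..int n}. array s ''I'' l > 0 \<longrightarrow> p j \<le> p l"
        by (auto simp: s' ar)
      with I have j: "j \<in> A - S" by blast
      have min: "p j \<le> p i" if "i \<in> A - S" for i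
        using that least I A by blast
      have below': "p i dvd p j" if "i \<in> insert j S" for i
        using that below above [OF j] by (auto intro: dvd_trans)
      \<comment> \<open>Here the order of selection matters: \<open>p j\<close> is the least
        remaining period, so harmonicity turns the inequality into divisibility.\<close>
      have above': "p j dvd p i" if "i \<in> A - insert j S" for i
        using that j min by (intro p_dvd) auto
      have D: "slack c p (insert j S) (p j) =
          scalar s' ''D'' * (p j div scalar s' ''q'') - array s' ''c'' j"
        using slack_insert [where p = p and c = c, OF fin _ below above [OF j] q] j p_pos [of j]
        by (simp add: s' sc ar)
      show "runs update_prog s' (n * 43 + 72) (\<lambda>s. \<exists>S. tabulates S (Suc r) s)"
      proof (rule runs_mono [OF update_prog_runs [OF _ _ _ D]])
        fix t
        assume "\<exists>e x. t = s'\<lparr>scalar := (scalar s')(''D'' := slack c p (insert j S) (p j), ''q'' := p j,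
            ''h'' := array s' ''H'' j, ''i'' := int n + 1, ''e'' := e, ''x'' := x),
          array := (array s')(''I'' := (array s' ''I'')(j := 0),
          ''H'' := (\<lambda>l. if 0 \<le> l \<and> l \<le> int n then
             (let e = (array s' ''J'' l - array s' ''J'' j) div p j in
              max (array s' ''H'' l + array s' ''c'' j * e)
                (array s' ''H'' j - (e + 1) * slack c p (insert j S) (p j)))
             else array s' ''H'' l))\<rparr>"
        then have "\<exists>e x. t = s\<lparr>scalar := (scalar s')(''D'' := slack c p (insert j S) (p j), ''q'' := p j,
            ''h'' := array s ''H'' j, ''i'' := int n + 1, ''e'' := e, ''x'' := x),
          array := (array s)(''I'' := (array s ''I'')(j := 0),
          ''H'' := (\<lambda>l. if 0 \<le> l \<and> l \<le> int n then
             (let e = (J l - J j) div p j in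
              max (array s ''H'' l + c j * e)
                (array s ''H'' j - (e + 1) * slack c p (insert j S) (p j)))
             else array s ''H'' l))\<rparr>"
          by (simp add: s' ar cong: if_cong)
        then obtain e x where t: "t = s\<lparr>scalar := (scalar s')(''D'' := slack c p (insert j S) (p j), ''q'' := p j,
            ''h'' := array s ''H'' j, ''i'' := int n + 1, ''e'' := e, ''x'' := x),
          array := (array s)(''I'' := (array s ''I'')(j := 0),
          ''H'' := (\<lambda>l. if 0 \<le> l \<and> l \<le> int n then
             (let e = (J l - J j) div p j in
              max (array s ''H'' l + c j * e)
                (array s ''H'' j - (e + 1) * slack c p (insert j S) (p j)))
             else array s ''H'' l))\<rparr>"
          by blast
        have peak: "is_peak (demand c p J (insert j S)) (J i) (array t ''H'' i)"
          if "i \<in> {0..int n}" for i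
          using that jn j S(1) below' H
          by (auto simp: t Let_def intro!: is_peak_demand_insert)
        show "\<exists>S. tabulates S (Suc r) t"
          unfolding tabulates_def
        proof (intro exI [of _ "insert j S"] conjI ballI)
          show "insert j S = A \<or> card (insert j S) = Suc r"
            using S j fin by auto
          show "0 < array t ''I'' i \<longleftrightarrow> i \<in> A - insert j S" if "i \<in> {1..int n}" for i
            using I [OF that] j by (auto simp: t)
        qed (use S j q below' above' peak n sc ar p_pos in \<open>auto simp: t s'\<close>)
      qed (simp_all add: s' n ar)
    }
  qed simp_all
qed

text \<open>The quadratic term comes from \<open>n\<close> rounds of linear cost; initialisation is
  linear and the final test constant. That test compares the peak at point \<open>0\<close> with
  \<open>\<gamma>\<close>.\<close>

lemma decide_prog_runs:
  assumes s: "scalar s ''n'' = int n" "scalar s ''i'' = 0" "scalar s ''r'' = 0"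
    "array s ''c'' = c" "array s ''p'' = p" "(array s ''J'')(0 := - scalar s ''k'') = J"
    and gamma: "scalar s ''gamma'' = \<gamma>"
    and I: "\<And>i. i\<in>{1..int n} \<Longrightarrow> array s ''I'' i > 0 \<longleftrightarrow> i \<in> A"
  shows "runs decide_prog s (n * n * 73 + n * 117 + 44)
     (\<lambda>s'. scalar s' ''result'' = (if \<exists>u\<ge>J 0. demand c p J A u \<ge> \<gamma> then 1 else 0))"
proof -
  let ?g = "Less (Var ''r'') (Var ''n'')"
  \<comment> \<open>For \<open>S = {}\<close> the choice \<open>q = 1\<close> divides every period,
    and the slack at \<open>1\<close> is \<open>1\<close>, the initial value of
    \<open>D\<close>.\<close>
  have start: "\<exists>S. tabulates S 0 s'"
    if "s' = s\<lparr>scalar := (scalar s)(''q'' := 1, ''D'' := 1, ''i'' := int n + 1),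
        array := (array s)(''J'' := J,
          ''H'' := (\<lambda>l. if 0 \<le> l \<and> l \<le> int n then - J l else array s ''H'' l))\<rparr>" for s'
    by (intro exI [of _ "{}"])
      (use s I gamma A in \<open>auto simp: tabulates_def that slack_def demand_def is_peak_def\<close>)
  have body: "bval ?g s' \<and> runs round_prog s' (n * 73 + 96) (\<lambda>s. \<exists>S. tabulates S (Suc r) s)"
    if "r < n" "\<exists>S. tabulates S r s'" for r s'
    using that round_prog_runs [OF that(2)] by (auto simp: tabulates_def)
  have stop: "\<not> bval ?g s'" if "\<exists>S. tabulates S n s'" for s'
    using that by (auto simp: tabulates_def)
  have final: "wp (Cond (Less (Read ''H'' (Const 0)) (Var ''gamma''))
            (Assign ''result'' (Const 0)) (Assign ''result'' (Const 1)))
      (\<lambda>s'. scalar s' ''result'' =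
         (if \<exists>u\<ge>J 0. demand c p J A u \<ge> \<gamma> then 1 else 0)) s'"
    if inv: "\<exists>S. tabulates S n s'" for s'
  proof -
    from inv obtain S where S: "S \<subseteq> A" "S = A \<or> card S = n"
      and \<gamma>: "scalar s' ''gamma'' = \<gamma>"
      and "\<forall>i\<in>{0..int n}. is_peak (demand c p J S) (J i) (array s' ''H'' i)"
      by (auto simp: tabulates_def)
    then have H: "is_peak (demand c p J S) (J 0) (array s' ''H'' 0)"
      by simp
    \<comment> \<open>Thus \<open>card S = n\<close> also forces \<open>S = A\<close>, so
      \<open>n\<close> rounds suffice.\<close>
    have "card A \<le> n"
      using card_mono [OF _ A] by simp
    with S have "S = A"
      using card_seteq [OF finite_A] by blast
    with H \<gamma> show ?thesis
      by (auto simp: is_peak_def intro: order_trans)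
  qed
  have init: "runs init_prog s (n * 17 + 31) (\<lambda>s. \<exists>S. tabulates S 0 s)"
    by (rule runs_mono [OF init_prog_runs [OF s(1,2) s(6) [symmetric]] order_refl start])
  have loop: "runs (While ?g round_prog) s' (n * (bcost ?g + 1 + (n * 73 + 96)) + (bcost ?g + 1))
      (\<lambda>s. \<exists>S. tabulates S n s)" if "\<exists>S. tabulates S 0 s'" for s'
    by (rule runs_While [where R = "\<lambda>r s. \<exists>S. tabulates S r s", OF that body stop])
  have "runs decide_prog s
      (n * 17 + 31 + (n * (bcost ?g + 1 + (n * 73 + 96)) + (bcost ?g + 1) +
        ccost (Cond (Less (Read ''H'' (Const 0)) (Var ''gamma''))
            (Assign ''result'' (Const 0)) (Assign ''result'' (Const 1)))))
      (\<lambda>s'. scalar s' ''result'' = (if \<exists>u\<ge>J 0. demand c p J A u \<ge> \<gamma> then 1 else 0))"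
    unfolding decide_prog_def
    by (intro runs_Seq [OF init] runs_Seq [OF loop] runs_wp final)
  then show ?thesis
    by (rule runs_mono) (simp_all add: distrib_left)
qed

end

section \<open>Response times\<close>

text \<open>A ceiling is the negative of the floor of the negated quotient, which yields integer
  division at \<open>u = - t\<close>. At \<open>p i = 0\<close> both sides of the identity are
  \<open>0\<close> by convention.\<close>

lemma response_bound_iff:
  fixes t :: nat
  shows "response_bound c p J I \<gamma> t \<longleftrightarrow>
     int \<gamma> \<le> (\<Sum>i\<in>I. int (c i) * ((- int t - int (J i)) div int (p i))) + int t"
proof -
  have "\<lceil>(real t + real (J i)) / real (p i)\<rceil> = - ((- int t - int (J i)) div int (p i))" for i
    using ceiling_divide_eq_div [of "int t + int (J i)" "int (p i)"] by simp
  then show ?thesis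
    by (auto simp: response_bound_def sum_negf)
qed

text \<open>A witness \<open>u \<ge> - k\<close> is moved down by multiples of the largest period
  \<open>q\<close> into the window of length \<open>q\<close> starting at \<open>- k\<close>. It
  lies below \<open>0\<close> because \<open>q \<le> k\<close>, and moving down never lowers the
  demand.\<close>

lemma response_time_le_iff:
  fixes k :: int
  assumes ts: "task_system n c d p J" and I: "I \<noteq> {}" "I \<subseteq> {1..n - 1}"
    and dvd: "\<And>i j. i \<in> I \<Longrightarrow> j \<in> I \<Longrightarrow> p i \<le> p j \<Longrightarrow> p i dvd p j"
    and k: "k \<ge> int (Max (p ` I))"
    and util: "(\<Sum>i\<in>I. real (c i) / real (p i)) \<le> 1"
  shows "int (response_time c p J I \<gamma>) \<le> k \<longleftrightarrow>
    (\<exists>u\<ge>- k. int \<gamma> \<le> demand (int \<circ> c) (int \<circ> p) (int \<circ> J) I u)"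
proof
  have fin: "finite I"
    using I(2) by (rule finite_subset) simp
  have pos: "p i > 0" if "i \<in> I" for i
  proof -
    have "i \<in> {1..n}" using I(2) that by fastforce
    with ts show ?thesis by (auto simp: task_system_def Suc_le_eq)
  qed
  have bound: "response_bound c p J I \<gamma> t \<longleftrightarrow>
      int \<gamma> \<le> demand (int \<circ> c) (int \<circ> p) (int \<circ> J) I (- int t)" for t
    by (simp add: response_bound_iff demand_def)
  {
    assume "int (response_time c p J I \<gamma>) \<le> k"
    with response_bound_response_time [OF ts I(2), of \<gamma>]
    show "\<exists>u\<ge>- k. int \<gamma> \<le> demand (int \<circ> c) (int \<circ> p) (int \<circ> J) I u"
      by (intro exI [of _ "- int (response_time c p J I \<gamma>)"]) (simp add: bound)
  next
    assume "\<exists>u\<ge>- k. int \<gamma> \<le> demand (int \<circ> c) (int \<circ> p) (int \<circ> J) I u"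
    then obtain u where u: "u \<ge> - k" "int \<gamma> \<le> demand (int \<circ> c) (int \<circ> p) (int \<circ> J) I u"
      by blast
    define q where "q = Max (p ` I)"
    have "q \<in> p ` I"
      unfolding q_def using fin I(1) by (intro Max_in) auto
    then have "q > 0"
      using pos by auto
    have q_dvd: "p i dvd q" if "i \<in> I" for i
    proof -
      have "p i \<le> q"
        unfolding q_def using fin that by (intro Max_ge) auto
      with \<open>q \<in> p ` I\<close> that dvd show ?thesis by blast
    qed
    \<comment> \<open>The number of whole periods between \<open>- k\<close> and \<open>u\<close>;
      the move gains \<open>m\<close> times the slack.\<close>
    define m where "m = (u + k) div int q"
    define v where "v = u + int q * (- m)"
    have m: "m \<ge> 0"
      using u(1) \<open>q > 0\<close> by (simp add: m_def pos_imp_zdiv_nonneg_iff)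
    have "v + k = (u + k) mod int q"
      by (simp add: v_def m_def minus_mult_div_eq_mod [symmetric])
    then have "0 \<le> v + k" "v + k < int q"
      using \<open>q > 0\<close> by simp_all
    with k have v: "- k \<le> v" "v \<le> 0"
      by (simp_all add: q_def)
    have "slack (int \<circ> c) (int \<circ> p) I (int q) \<ge> 0"
      using q_dvd util by (intro slack_nonneg) auto
    then have "0 \<le> m * slack (int \<circ> c) (int \<circ> p) I (int q)"
      using m by simp
    moreover have "demand (int \<circ> c) (int \<circ> p) (int \<circ> J) I v =
        demand (int \<circ> c) (int \<circ> p) (int \<circ> J) I u - (- m) * slack (int \<circ> c) (int \<circ> p) I (int q)"
      unfolding v_def using pos q_dvd by (intro demand_shift) auto
    ultimately have "int \<gamma> \<le> demand (int \<circ> c) (int \<circ> p) (int \<circ> J) I v"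
      using u(2) by simp
    then have "response_bound c p J I \<gamma> (nat (- v))"
      using v by (simp add: bound)
    then have "response_time c p J I \<gamma> \<le> nat (- v)"
      unfolding response_time_def by (rule Least_le)
    with v show "int (response_time c p J I \<gamma>) \<le> k"
      by linarith
  }
qed

section \<open>The decision procedure on encoded inputs\<close>

theorem theorem11:
  "\<exists>(P :: com) (T :: nat \<Rightarrow> nat).
     (\<lambda>n. real (T n)) \<in> O(\<lambda>n. (real n)\<^sup>2) \<and>
     (\<forall>(n :: nat) (c :: nat \<Rightarrow> nat) (d :: nat \<Rightarrow> nat) (p :: nat \<Rightarrow> nat) (J :: nat \<Rightarrow> nat)
        (I :: nat set) (\<gamma> :: nat) (k :: int).
        n \<ge> 2 \<and> task_system n c d p J \<and> harmonic n p \<and>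
        I \<noteq> {} \<and> I \<subseteq> {1..n - 1} \<and> \<gamma> \<ge> 1 \<and> k \<ge> int (Max (p ` I))
        \<longrightarrow> decides_within P (input_state n c d p J I \<gamma> k) (T n)
              (int (response_time c p J I \<gamma>) \<le> k))"
proof -
  have main: "decides_within decide_prog (input_state n c d p J I \<gamma> k) (234 * n\<^sup>2)
              (int (response_time c p J I \<gamma>) \<le> k)"
    if n: "n \<ge> 2" and ts: "task_system n c d p J" and harm: "harmonic n p"
      and I: "I \<noteq> {}" "I \<subseteq> {1..n - 1}" and k: "k \<ge> int (Max (p ` I))"
    for n c d p J I \<gamma> k
  proof -
    \<comment> \<open>The offsets as they stand after initialisation; index \<open>0\<close> is not
      a task, so those of the tasks in \<open>I\<close> are unchanged.\<close>
    define J' where "J' = (input_array n J)(0 := - k)"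
    have I_sub: "I \<subseteq> {1..<n}"
      using I(2) by fastforce
    have in_n: "i \<in> {1..n}" if "i \<in> I" for i
      using I_sub that by fastforce
    have pos: "p i > 0" if "i \<in> I" for i
      using ts in_n [OF that] by (auto simp: task_system_def Suc_le_eq)
    have input: "input_array n f (int i) = int (f i)" if "i \<in> I" for f i
      using in_n [OF that] by (simp add: input_array_def)
    have J': "J' (int i) = int (J i)" if "i \<in> I" for i
      using in_n [OF that] by (simp add: J'_def input that)
    have dvd: "p i dvd p j" if "i \<in> I" "j \<in> I" "p i \<le> p j" for i j
    proof -
      have "real (p j) / real (p i) \<in> \<int>"
        using harm that in_n by (auto simp: harmonic_def)
      then have "real_of_int (int (p j)) / real_of_int (int (p i)) \<in> \<int>"
        by simp
      then obtain m where "real_of_int (int (p j)) / real_of_int (int (p i)) = real_of_int m"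
        by (auto elim: Ints_cases)
      then have "real_of_int (int (p j)) = real_of_int (m * int (p i))"
        using pos [OF that(1)] by (simp add: field_simps)
      then have "int (p j) = m * int (p i)"
        by (simp only: of_int_eq_iff)
      then have "int (p i) dvd int (p j)"
        by simp
      then show ?thesis by simp
    qed
    have "(\<Sum>i\<in>I. real (c i) / real (p i)) \<le> (\<Sum>i\<in>{1..<n}. real (c i) / real (p i))"
      using I_sub by (intro sum_mono2) auto
    then have util_I: "(\<Sum>i\<in>I. real (c i) / real (p i)) \<le> 1"
      using ts by (simp add: task_system_def)
    interpret harmonic_demand n "int \<gamma>" "input_array n c" "input_array n p" J' "int ` I"
    proof
      show "int ` I \<subseteq> {1..int n}"
        using in_n by fastforce
      show "(\<Sum>i\<in>int ` I. real_of_int (input_array n c i) / real_of_int (input_array n p i)) \<le> 1"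
        using util_I by (simp add: sum.reindex input)
    qed (auto simp: input pos dvd)
    let ?s = "input_state n c d p J I \<gamma> k"
    have demand: "demand (input_array n c) (input_array n p) J' (int ` I) u =
        demand (int \<circ> c) (int \<circ> p) (int \<circ> J) I u" for u
      by (simp add: demand_def sum.reindex input J')
    have "runs decide_prog ?s (n * n * 73 + n * 117 + 44)
       (\<lambda>s'. scalar s' ''result'' = (if int (response_time c p J I \<gamma>) \<le> k then 1 else 0))"
    proof (rule runs_mono [OF decide_prog_runs])
      show "array ?s ''I'' i > 0 \<longleftrightarrow> i \<in> int ` I" if "i \<in> {1..int n}" for i
      proof -
        have "i = int (nat i)" using that by simp
        then obtain l where "i = int l" ..
        with that show ?thesis by (auto simp: input_state_def input_array_def)
      qed
      show "(array ?s ''J'')(0 := - scalar ?s ''k'') = J'"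
        by (simp add: input_state_def J'_def)
      have "J' 0 = - k" by (simp add: J'_def)
      then show "scalar s' ''result'' = (if int (response_time c p J I \<gamma>) \<le> k then 1 else 0)"
        if "scalar s' ''result'' = (if \<exists>u\<ge>J' 0. int \<gamma> \<le>
          demand (input_array n c) (input_array n p) J' (int ` I) u then 1 else 0)" for s'
        using that by (simp add: demand response_time_le_iff [OF ts I dvd k util_I])
    qed (simp_all add: input_state_def)
    \<comment> \<open>The constant is 73 + 117 + 44, as \<open>n\<close> and \<open>1\<close> are
      both at most \<open>n * n\<close>.\<close>
    moreover have "n * n * 73 + n * 117 + 44 \<le> 234 * n\<^sup>2"
    proof -
      have "n \<le> n * n" "1 \<le> n * n" using n by auto
      then have "n * n * 73 + n * 117 + 44 \<le> 234 * (n * n)" by linarith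
      then show ?thesis by (simp only: power2_eq_square)
    qed
    ultimately show ?thesis
      unfolding decides_within_def runs_def by (meson order_trans)
  qed
  show ?thesis
    by (intro exI [of _ decide_prog] exI [of _ "\<lambda>n. 234 * n\<^sup>2"] conjI) (use main in simp_all)
qed

end
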